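(* For $n\ge 1$, the expected number of lucky spots of a uniformly random weakly-decreasing parking function of $1,\ldots,n$ is $\frac12(n+1)$.
   Context: There are $n$ spots labeled $1,\ldots,n$ in order along a one-way street, and $n$ cars entering one after another, car $i$ having preference $a_i\in\{1,\ldots,n\}$. Each car drives to its preferred spot and parks there if it is available; otherwise it moves forward and parks in the first available later spot, if any (if none, it fails to park). A parking function of $1,\ldots,n$ is a sequence of preferences $(a_1,\ldots,a_n)$ such that all $n$ cars are able to park; it is weakly-decreasing if $a_1\ge a_2\ge\cdots\ge a_n$. A spot is lucky if the car that parks in it prefers that spot. *)

theory Defs
  imports "HOL-Probability.Probability"
begin

definition free_spots_from :: "nat \<Rightarrow> nat set \<Rightarrow> nat \<Rightarrow> nat set" where
  "free_spots_from n occ a = {s. a \<le> s \<and> s \<le> n \<and> s \<notin> occ}"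

text \<open>The spot taken by a car with preference \<open>a\<close> when the spots in \<open>occ\<close> are occupied:
  \<open>a\<close> itself if it is free, otherwise the first free later spot; \<open>None\<close> if the car fails to park.\<close>

definition park_car :: "nat \<Rightarrow> nat set \<Rightarrow> nat \<Rightarrow> nat option" where
  "park_car n occ a =
     (if free_spots_from n occ a = {} then None else Some (Min (free_spots_from n occ a)))"

text \<open>The outcomes for a queue of cars, in order of entry, starting with \<open>occ\<close> occupied.\<close>

primrec park_cars :: "nat \<Rightarrow> nat set \<Rightarrow> nat list \<Rightarrow> nat option list" where
  "park_cars n occ [] = []"
| "park_cars n occ (a # prefs) =
     (let s = park_car n occ a in s # park_cars n (occ \<union> set_option s) prefs)"

definition parking_function :: "nat \<Rightarrow> nat list \<Rightarrow> bool" where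
  "parking_function n prefs \<longleftrightarrow>
     length prefs = n \<and> set prefs \<subseteq> {1..n} \<and> None \<notin> set (park_cars n {} prefs)"

definition weakly_decreasing_parking_functions :: "nat \<Rightarrow> nat list set" where
  "weakly_decreasing_parking_functions n =
     {prefs. parking_function n prefs \<and> sorted_wrt (\<ge>) prefs}"

text \<open>List positions count from 0, so the car at position \<open>i\<close> is car \<open>i + 1\<close>.\<close>

definition lucky_spots :: "nat \<Rightarrow> nat list \<Rightarrow> nat set" where
  "lucky_spots n prefs =
     {s \<in> {1..n}. \<exists>i < length prefs. park_cars n {} prefs ! i = Some s \<and> prefs ! i = s}"

text \<open>The next two facts make \<^const>\<open>pmf_of_set\<close> on these sets the uniform distribution.\<close>

lemma finite_weakly_decreasing_parking_functions:
  "finite (weakly_decreasing_parking_functions n)"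
  by (rule finite_subset[OF _ finite_lists_length_eq[of "{1..n}" n]])
     (auto simp: weakly_decreasing_parking_functions_def parking_function_def)

lemma weakly_decreasing_parking_functions_nonempty:
  "weakly_decreasing_parking_functions n \<noteq> {}"
proof -
  have park: "park_cars n {Suc k..n} (rev [1..<Suc k]) = map Some (rev [1..<Suc k])"
    if "k \<le> n" for k
    using that
  proof (induction k)
    case (Suc k)
    have "free_spots_from n {Suc (Suc k)..n} (Suc k) = {Suc k}"
      using Suc.prems by (auto simp: free_spots_from_def)
    moreover have "insert (Suc k) {Suc (Suc k)..n} = {Suc k..n}"
      using Suc.prems by auto
    ultimately show ?case
      using Suc by (simp add: park_car_def)
  qed simp
  have "rev [1..<Suc n] \<in> weakly_decreasing_parking_functions n"
    using park[of n] sorted_wrt_mono_rel[of "[1..<Suc n]" "(<)" "(\<le>)"]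
    by (auto simp: weakly_decreasing_parking_functions_def parking_function_def sorted_wrt_rev
        simp del: upt_Suc)
  then show ?thesis by blast
qed

end

theory Submission
  imports Defs
begin

text \<open>
  In a weakly decreasing queue, the first car preferring a spot \<open>a\<close> only meets cars that prefer, and
  hence occupy, spots beyond \<open>a\<close>; so the lucky spots are exactly the preferred spots, and the
  parking condition is \<open>a\<^sub>i \<le> n + 1 - i\<close>. Reading the queue backwards gives a staircase,
  which is encoded by its set \<open>A\<close> of jump positions and its set \<open>D\<close> of nonzero (shifted) values,
  two subsets of \<open>{1..<n}\<close> of equal size with \<open>|A \<inter> [t]| \<le> |D \<inter> [t]|\<close> for all \<open>t\<close>.
  The Lalanne--Kreweras involution, sending \<open>(A, D)\<close> to the complements of \<open>D\<close> and \<open>A\<close>, preserves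
  these conditions and replaces the size \<open>k\<close> by \<open>n - 1 - k\<close>, so the mean size is \<open>(n - 1) / 2\<close>.
\<close>

section \<open>Parking weakly decreasing queues\<close>

lemma finite_free_spots_from [simp]: "finite (free_spots_from n occ a)"
  by (rule finite_subset[of _ "{..n}"]) (auto simp: free_spots_from_def)

lemma length_park_cars [simp]: "length (park_cars n occ prefs) = length prefs"
  by (induction prefs arbitrary: occ) (auto simp: Let_def)

lemma park_car_SomeD:
  assumes "park_car n occ a = Some s"
  shows "a \<le> s" "s \<le> n" "s \<notin> occ"
proof -
  have "s \<in> free_spots_from n occ a"
    using assms by (auto simp: park_car_def split: if_splits intro: Min_in)
  then show "a \<le> s" "s \<le> n" "s \<notin> occ" by (auto simp: free_spots_from_def)
qed

lemma park_car_free: "a \<le> n \<Longrightarrow> a \<notin> occ \<Longrightarrow> park_car n occ a = Some a"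
  by (auto simp: park_car_def free_spots_from_def intro!: Min_eqI
      intro: finite_subset[of _ "{..n}"])

text \<open>When every occupied spot lies in the tail \<open>{a..n}\<close>, a car preferring
  \<open>a\<close> fails exactly if that tail is full, so \<open>card occ\<close> alone detects
  failure.\<close>

lemma park_car_eq_None_iff:
  assumes "occ \<subseteq> {a..n}" "a \<le> n"
  shows "park_car n occ a = None \<longleftrightarrow> n < a + card occ"
proof -
  have fin: "finite occ" using assms(1) finite_subset by blast
  have "park_car n occ a = None \<longleftrightarrow> occ = {a..n}"
    using assms by (auto simp: park_car_def free_spots_from_def)
  also have "\<dots> \<longleftrightarrow> card {a..n} \<le> card occ"
    using assms(1) card_seteq[of "{a..n}" occ] by auto
  finally show ?thesis using assms(2) by auto
qed

text \<open>The last assumption is the induction invariant: a car parks at or beyond its preference,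
  and later preferences are no larger. Each parked car adds one to \<open>card occ\<close>, which
  the index \<open>i\<close> accounts for.\<close>

lemma all_park_decreasing_iff:
  assumes "sorted_wrt (\<ge>) prefs" "set prefs \<subseteq> {..n}" "occ \<subseteq> {..n}"
    and "\<And>a s. a \<in> set prefs \<Longrightarrow> s \<in> occ \<Longrightarrow> a \<le> s"
  shows "None \<notin> set (park_cars n occ prefs) \<longleftrightarrow>
    (\<forall>i < length prefs. prefs ! i + i + card occ \<le> n)"
  using assms
proof (induction prefs arbitrary: occ)
  case (Cons a prefs)
  have N: "park_car n occ a = None \<longleftrightarrow> n < a + card occ"
    by (rule park_car_eq_None_iff) (use Cons.prems in auto)
  show ?case
  proof (cases "park_car n occ a")
    case None
    then show ?thesis using N by (auto intro!: exI[of _ 0])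
  next
    case (Some s)
    note s = park_car_SomeD[OF Some]
    have "None \<notin> set (park_cars n (insert s occ) prefs) \<longleftrightarrow>
        (\<forall>i < length prefs. prefs ! i + i + card (insert s occ) \<le> n)"
      by (rule Cons.IH) (use Cons.prems s in \<open>auto intro: order_trans\<close>)
    moreover have "card (insert s occ) = Suc (card occ)"
      using s Cons.prems(3) by (simp add: finite_subset)
    ultimately show ?thesis using Some N by (auto simp: All_less_Suc2)
  qed
qed simp

text \<open>The induction needs arbitrary \<open>occ\<close>. A free preference is taken by its
  first claimant and is occupied from then on; a blocked car ends, if it parks, strictly beyond its
  preference, at a spot that no later car prefers.\<close>

lemma lucky_decreasing:
  assumes "sorted_wrt (\<ge>) prefs" "set prefs \<subseteq> {..n}"
  shows "{s. (Some s, s) \<in> set (zip (park_cars n occ prefs) prefs)} = set prefs - occ"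
  using assms
proof (induction prefs arbitrary: occ)
  case (Cons a prefs)
  let ?s = "park_car n occ a"
  have IH: "{s. (Some s, s) \<in> set (zip (park_cars n (occ \<union> set_option ?s) prefs) prefs)} =
      set prefs - (occ \<union> set_option ?s)"
    using Cons by auto
  have "{s. (Some s, s) \<in> set (zip (park_cars n occ (a # prefs)) (a # prefs))} =
      {s. ?s = Some s \<and> s = a} \<union> (set prefs - (occ \<union> set_option ?s))"
    unfolding IH[symmetric] by (auto simp: Let_def)
  also have "\<dots> = set (a # prefs) - occ"
  proof (cases "a \<in> occ")
    case False
    then show ?thesis using Cons.prems by (auto simp: park_car_free)
  next
    case True
    then have "t \<notin> set_option ?s" if "t \<in> set prefs" for t
      using park_car_SomeD[of n occ a t] Cons.prems(1) that
      by (metis dual_order.antisym elem_set sorted_wrt.simps(2))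
    then show ?thesis using True by (auto dest: park_car_SomeD(3))
  qed
  finally show ?case .
qed simp

lemma lucky_spots_decreasing:
  assumes "sorted_wrt (\<ge>) prefs" "set prefs \<subseteq> {1..n}"
  shows "lucky_spots n prefs = set prefs"
proof -
  have "lucky_spots n prefs =
      {1..n} \<inter> {s. (Some s, s) \<in> set (zip (park_cars n {} prefs) prefs)}"
    by (auto simp: lucky_spots_def set_zip) metis
  also have "\<dots> = set prefs"
    using assms by (subst lucky_decreasing) auto
  finally show ?thesis .
qed

section \<open>Staircases\<close>

text \<open>These encode Dyck paths by heights below the diagonal. The bound is the parking
  condition \<open>prefs ! i + i \<le> n\<close> after reversal and a shift of the values to start
  at 0.\<close>

definition staircases :: "nat \<Rightarrow> nat list set" where
  "staircases n = {b. length b = n \<and> sorted b \<and> (\<forall>i < n. b ! i \<le> i)}"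

lemma bij_betw_staircases:
  "bij_betw (\<lambda>b. rev (map Suc b)) (staircases n) (weakly_decreasing_parking_functions n)"
proof (rule bij_betwI[where g = "\<lambda>p. map (\<lambda>x. x - 1) (rev p)"])
  show "(\<lambda>b. rev (map Suc b)) \<in> staircases n \<rightarrow> weakly_decreasing_parking_functions n"
  proof
    fix b assume "b \<in> staircases n"
    then have b: "length b = n" "sorted b" "\<And>i. i < n \<Longrightarrow> b ! i \<le> i"
      by (auto simp: staircases_def)
    let ?p = "rev (map Suc b)"
    have sp: "sorted_wrt (\<ge>) ?p"
      using b(2) by (simp add: sorted_wrt_rev sorted_wrt_map)
    have set: "set ?p \<subseteq> {1..n}"
      using b by (force simp: in_set_conv_nth)
    \<comment> \<open>Entry \<open>i\<close> from the front is entry \<open>n - Suc i\<close> of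
      \<open>b\<close>, and the added \<open>Suc\<close> turns its bound into
      \<open>n - i\<close>.\<close>
    have "?p ! i + i \<le> n" if "i < n" for i
      using b(3)[of "n - Suc i"] b(1) that by (simp add: rev_nth)
    then have "None \<notin> set (park_cars n {} ?p)"
      using set by (subst all_park_decreasing_iff[OF sp]) (auto simp: b(1))
    with sp set b(1) show "?p \<in> weakly_decreasing_parking_functions n"
      by (simp add: weakly_decreasing_parking_functions_def parking_function_def)
  qed
next
  show "(\<lambda>p. map (\<lambda>x. x - 1) (rev p)) \<in> weakly_decreasing_parking_functions n \<rightarrow> staircases n"
  proof
    fix p assume "p \<in> weakly_decreasing_parking_functions n"
    then have p: "length p = n" "set p \<subseteq> {1..n}" "sorted_wrt (\<ge>) p"
        "None \<notin> set (park_cars n {} p)"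
      by (auto simp: weakly_decreasing_parking_functions_def parking_function_def)
    have le: "p ! i + i \<le> n" if "i < n" for i
      using p(4) that p(1,2) by (subst (asm) all_park_decreasing_iff[OF p(3)]) auto
    have "sorted (map (\<lambda>x. x - 1) (rev p))"
      using p(3) by (auto simp: sorted_wrt_map sorted_wrt_rev elim!: sorted_wrt_mono_rel[rotated])
    moreover have "map (\<lambda>x. x - 1) (rev p) ! i \<le> i" if "i < n" for i
      using le[of "n - Suc i"] that p(1) by (simp add: rev_nth)
    ultimately show "map (\<lambda>x. x - 1) (rev p) \<in> staircases n"
      using p(1) by (simp add: staircases_def)
  qed
next
  show "rev (map Suc (map (\<lambda>x. x - 1) (rev p))) = p"
    if "p \<in> weakly_decreasing_parking_functions n" for p
  proof -
    \<comment> \<open>Truncated subtraction is undone by \<open>Suc\<close> because preferences are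
      at least 1.\<close>
    have "map (Suc \<circ> (\<lambda>x. x - 1)) p = p"
      by (rule map_idI)
        (use that in \<open>auto simp: weakly_decreasing_parking_functions_def parking_function_def\<close>)
    then show ?thesis by (simp add: rev_map)
  qed
qed (simp add: rev_map comp_def)

section \<open>Ranks\<close>

lemma card_atMost_less:
  fixes D :: "nat set"
  assumes "y \<in> D" "x < y"
  shows "card (D \<inter> {..x}) < card (D \<inter> {..y})"
proof (rule psubset_card_mono)
  have "y \<in> D \<inter> {..y} - D \<inter> {..x}" using assms by auto
  then show "D \<inter> {..x} \<subset> D \<inter> {..y}" using assms(2) by force
qed simp

text \<open>The rank in \<open>D\<close> increases strictly along \<open>insert 0 D\<close>, so it
  determines elements there. Leaving \<open>y\<close> arbitrary allows comparison with a position as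
  well as with a value.\<close>

lemma card_atMost_le_iff:
  fixes D :: "nat set"
  assumes "x \<in> insert 0 D"
  shows "card (D \<inter> {..x}) \<le> card (D \<inter> {..y}) \<longleftrightarrow> x \<le> y"
proof
  show "x \<le> y" if "card (D \<inter> {..x}) \<le> card (D \<inter> {..y})"
    using card_atMost_less[of x D y] assms that by (metis insert_iff leD leI zero_le)
  show "card (D \<inter> {..x}) \<le> card (D \<inter> {..y})" if "x \<le> y"
    using that by (intro card_mono) auto
qed

lemma card_atMost_eq_iff:
  fixes D :: "nat set"
  assumes "x \<in> insert 0 D" "y \<in> insert 0 D"
  shows "card (D \<inter> {..x}) = card (D \<inter> {..y}) \<longleftrightarrow> x = y"
  using card_atMost_le_iff[OF assms(1), of y] card_atMost_le_iff[OF assms(2), of x] by auto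

lemma ex_rank:
  fixes D :: "nat set"
  assumes "finite D" "0 \<notin> D" "j \<le> card D"
  shows "\<exists>x \<in> insert 0 D. card (D \<inter> {..x}) = j"
  using assms(3)
proof (induction j)
  case 0
  have "D \<inter> {..0} = {}" using assms(2) by auto
  then show ?case by auto
next
  case (Suc j)
  then obtain x where x: "card (D \<inter> {..x}) = j" using Suc_leD by blast
  then have "D \<inter> {..x} \<noteq> D" using Suc.prems by auto
  then have ne: "D \<inter> {x<..} \<noteq> {}" by auto
  \<comment> \<open>The next element of \<open>D\<close> after \<open>x\<close>: passing it raises
    the rank by exactly one.\<close>
  define y where "y = Min (D \<inter> {x<..})"
  have y: "y \<in> D" "x < y" using Min_in[OF _ ne] assms(1) by (auto simp: y_def)
  have "D \<inter> {..y} = insert y (D \<inter> {..x})"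
  proof -
    have "z \<le> x" if "z \<in> D" "z \<le> y" "z \<noteq> y" for z
    proof (rule ccontr)
      assume "\<not> z \<le> x"
      then have "y \<le> z" unfolding y_def using that assms(1) by (intro Min_le) auto
      then show False using that by simp
    qed
    then show ?thesis using y by auto
  qed
  then have "card (D \<inter> {..y}) = Suc j" using x y by simp
  then show ?case using y by auto
qed

section \<open>Encoding staircases by jumps and values\<close>

definition ballot_pairs :: "nat \<Rightarrow> (nat set \<times> nat set) set" where
  "ballot_pairs n = {(A, D). A \<subseteq> {1..<n} \<and> D \<subseteq> {1..<n} \<and> card A = card D \<and>
     (\<forall>t. card (A \<inter> {..t}) \<le> card (D \<inter> {..t}))}"

text \<open>A staircase starts at 0, so position 0 is left out, just as \<open>encode\<close> drops
  the value 0; jumps then match nonzero values one to one.\<close>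

definition jumps :: "nat list \<Rightarrow> nat set" where
  "jumps b = {i \<in> {1..<length b}. b ! (i - 1) < b ! i}"

definition encode :: "nat list \<Rightarrow> nat set \<times> nat set" where
  "encode b = (jumps b, set b - {0})"

text \<open>Along a sorted list the entry changes only at jumps, and each jump reaches the next
  larger value of the list. Hence the jumps and the value set together determine every
  entry.\<close>

lemma rank_nth_eq_card_jumps:
  assumes "sorted b" "b ! 0 = 0" "i < length b"
  shows "card ((set b - {0}) \<inter> {..b ! i}) = card (jumps b \<inter> {..i})"
  using assms(3)
proof (induction i)
  case 0
  have "(set b - {0}) \<inter> {..b ! 0} = {}" "jumps b \<inter> {..0} = {}"
    using assms(2) by (auto simp: jumps_def)
  then show ?case by (simp only:)
next
  case (Suc i)
  have IH: "card ((set b - {0}) \<inter> {..b ! i}) = card (jumps b \<inter> {..i})"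
    using Suc by simp
  have mono: "b ! k \<le> b ! l" if "k \<le> l" "l < length b" for k l
    using assms(1) that by (simp add: sorted_nth_mono)
  show ?case
  proof (cases "b ! i < b ! Suc i")
    case True
    have "v \<le> b ! i" if v: "v \<in> set b" "v \<le> b ! Suc i" "v \<noteq> b ! Suc i" for v
    proof -
      obtain k where k: "k < length b" "v = b ! k" using v(1) by (auto simp: in_set_conv_nth)
      have "\<not> Suc i \<le> k" using mono[of "Suc i" k] k v by auto
      then show ?thesis using mono[of k i] k Suc.prems by auto
    qed
    then have 1: "(set b - {0}) \<inter> {..b ! Suc i} = insert (b ! Suc i) ((set b - {0}) \<inter> {..b ! i})"
      using True Suc.prems by auto
    have 2: "jumps b \<inter> {..Suc i} = insert (Suc i) (jumps b \<inter> {..i})"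
      using True Suc.prems by (auto simp: jumps_def le_Suc_eq)
    show ?thesis unfolding 1 2 using IH True by simp
  next
    case False
    then have 1: "b ! Suc i = b ! i" using mono[of i "Suc i"] Suc.prems by simp
    then have 2: "jumps b \<inter> {..Suc i} = jumps b \<inter> {..i}"
      by (auto simp: jumps_def le_Suc_eq)
    show ?thesis unfolding 1 2 by (rule IH)
  qed
qed

lemma staircasesD:
  assumes "b \<in> staircases n" "n \<ge> 1"
  shows "length b = n" "sorted b" "b ! 0 = 0" "\<And>i. i < n \<Longrightarrow> b ! i \<le> i" "0 \<in> set b"
proof -
  show 1: "length b = n" "sorted b" "\<And>i. i < n \<Longrightarrow> b ! i \<le> i"
    using assms by (auto simp: staircases_def)
  show "b ! 0 = 0" using 1(3)[of 0] assms(2) by simp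
  then show "0 \<in> set b" using 1(1) assms(2) nth_mem[of 0 b] by simp
qed

lemma encode_in_ballot_pairs:
  assumes "b \<in> staircases n" "n \<ge> 1"
  shows "encode b \<in> ballot_pairs n"
proof -
  note b = staircasesD[OF assms]
  define A where "A = jumps b"
  define D where "D = set b - {0}"
  have rank: "card (D \<inter> {..b ! i}) = card (A \<inter> {..i})" if "i < n" for i
    unfolding A_def D_def by (rule rank_nth_eq_card_jumps) (use b that in auto)
  have A: "A \<subseteq> {1..<n}" using b(1) by (auto simp: A_def jumps_def)
  have D: "D \<subseteq> {1..<n}" using b(1,4) by (force simp: D_def in_set_conv_nth)
  \<comment> \<open>At the last position all values and all jumps have been counted, so the rank
    identity there yields \<open>card A = card D\<close>.\<close>
  have last: "D \<inter> {..b ! (n - 1)} = D"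
  proof -
    have "v \<le> b ! (n - 1)" if "v \<in> set b" for v
      using that b(1,2) by (auto simp: in_set_conv_nth intro!: sorted_nth_mono)
    then show ?thesis by (auto simp: D_def)
  qed
  have "A \<inter> {..n - 1} = A" using A by force
  then have card: "card A = card D" using rank[of "n - 1"] last assms(2) by simp
  have "card (A \<inter> {..t}) \<le> card (D \<inter> {..t})" for t
  proof (cases "t < n")
    case True
    then have "card (A \<inter> {..t}) = card (D \<inter> {..b ! t})" by (simp add: rank)
    \<comment> \<open>The staircase bound \<open>b ! t \<le> t\<close> becomes the ballot
      inequality.\<close>
    also have "\<dots> \<le> card (D \<inter> {..t})" using b(4)[OF True] by (intro card_mono) auto
    finally show ?thesis .
  next
    case False
    then have "A \<inter> {..t} = A" "D \<inter> {..t} = D" using A D by auto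
    then show ?thesis using card by simp
  qed
  then show ?thesis using A D card by (simp add: ballot_pairs_def encode_def A_def D_def)
qed

lemma inj_on_encode:
  assumes "n \<ge> 1"
  shows "inj_on encode (staircases n)"
proof (rule inj_onI)
  fix b c assume "b \<in> staircases n" "c \<in> staircases n" and eq: "encode b = encode c"
  note b = staircasesD[OF this(1) assms] and c = staircasesD[OF this(2) assms]
  show "b = c"
  proof (rule nth_equalityI)
    fix i assume i: "i < length b"
    define D where "D = set b - {0}"
    have D: "D = set c - {0}" and J: "jumps b = jumps c"
      using eq by (auto simp: encode_def D_def)
    have "card (D \<inter> {..b ! i}) = card (D \<inter> {..c ! i})"
      using rank_nth_eq_card_jumps[OF b(2,3), of i] rank_nth_eq_card_jumps[OF c(2,3), of i]
        b(1) c(1) i J by (simp add: D_def[symmetric] D[symmetric])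
    moreover have "b ! i \<in> insert 0 D" using i by (simp add: D_def)
    moreover have "c ! i \<in> insert 0 D" using i b(1) c(1) by (simp add: D)
    ultimately show "b ! i = c ! i" by (simp only: card_atMost_eq_iff)
  qed (simp add: b(1) c(1))
qed

text \<open>The rank identity is inverted: entry \<open>i\<close> has to be the element of
  \<open>insert 0 D\<close> whose rank is the number of elements of \<open>A\<close> up to
  \<open>i\<close>. The ballot inequality keeps this entry at most \<open>i\<close>.\<close>

lemma ballot_pairs_subset_encode:
  assumes "n \<ge> 1"
  shows "ballot_pairs n \<subseteq> encode ` staircases n"
proof clarify
  fix A D assume "(A, D) \<in> ballot_pairs n"
  then have A: "A \<subseteq> {1..<n}" and D: "D \<subseteq> {1..<n}" and card: "card A = card D"
    and le: "\<And>t. card (A \<inter> {..t}) \<le> card (D \<inter> {..t})"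
    by (auto simp: ballot_pairs_def)
  have fin: "finite A" "finite D" using A D finite_subset by blast+
  have zero: "0 \<notin> A" using A by auto
  have "\<exists>x \<in> insert 0 D. card (D \<inter> {..x}) = card (A \<inter> {..i})" for i
  proof (rule ex_rank)
    show "card (A \<inter> {..i}) \<le> card D" unfolding card[symmetric] using fin by (intro card_mono) auto
  qed (use fin D in auto)
  then obtain f where f: "\<And>i. f i \<in> insert 0 D"
    and rank: "\<And>i. card (D \<inter> {..f i}) = card (A \<inter> {..i})" by metis
  define b where "b = map f [0..<n]"
  have f_le: "f i \<le> f j \<longleftrightarrow> card (A \<inter> {..i}) \<le> card (A \<inter> {..j})" for i j
    using card_atMost_le_iff[OF f, of i "f j"] by (simp add: rank)
  have f_mono: "f i \<le> f j" if "i \<le> j" for i j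
    unfolding f_le using that by (intro card_mono) auto
  have "sorted b" by (auto simp: b_def sorted_iff_nth_mono f_mono)
  moreover have "f i \<le> i" for i
    using card_atMost_le_iff[OF f, of i i] le[of i] by (simp add: rank)
  ultimately have "b \<in> staircases n" by (simp add: staircases_def b_def)
  moreover have "jumps b = A"
  proof -
    have "f (i - 1) < f i \<longleftrightarrow> i \<in> A" if "i \<ge> 1" for i
    proof (cases "i \<in> A")
      case True
      then have "card (A \<inter> {..i - 1}) < card (A \<inter> {..i})"
        using that by (intro card_atMost_less) auto
      then show ?thesis using True f_le[of i "i - 1"] by auto
    next
      case False
      have "A \<inter> {..i} = A \<inter> {..i - 1}"
        using False by (auto simp: le_eq_less_or_eq)
      then show ?thesis using False f_le[of i "i - 1"] by auto
    qed
    moreover have "jumps b = {i \<in> {1..<n}. f (i - 1) < f i}"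
      by (auto simp: jumps_def b_def)
    ultimately show ?thesis using A by auto
  qed
  moreover have "set b - {0} = D"
  proof
    show "set b - {0} \<subseteq> D" using f by (auto simp: b_def)
    show "D \<subseteq> set b - {0}"
    proof
      fix d assume d: "d \<in> D"
      \<comment> \<open>Since \<open>card A = card D\<close>, the rank of \<open>d\<close> in
        \<open>D\<close> is also attained as a rank in \<open>A\<close>, and at that position the
        staircase takes the value \<open>d\<close>.\<close>
      have "card (D \<inter> {..d}) \<le> card A" unfolding card using fin by (intro card_mono) auto
      then obtain i where i: "i \<in> insert 0 A" "card (A \<inter> {..i}) = card (D \<inter> {..d})"
        using ex_rank[OF fin(1) zero] by blast
      then have "f i = d" using card_atMost_eq_iff[OF f, of d i] d by (simp add: rank)
      moreover have "i < n" using i(1) A assms by auto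
      moreover have "d \<noteq> 0" using d D by auto
      ultimately show "d \<in> set b - {0}" by (auto simp: b_def)
    qed
  qed
  ultimately show "(A, D) \<in> encode ` staircases n" by (force simp: encode_def)
qed

lemma bij_betw_encode:
  assumes "n \<ge> 1"
  shows "bij_betw encode (staircases n) (ballot_pairs n)"
  unfolding bij_betw_def
  using inj_on_encode ballot_pairs_subset_encode encode_in_ballot_pairs assms by blast

section \<open>The Lalanne--Kreweras involution\<close>

text \<open>Complementing in \<open>{1..<n}\<close> reverses the inequality between the counts up to
  \<open>t\<close>, and exchanging the two sets turns it back.\<close>

lemma complement_in_ballot_pairs:
  assumes "(A, D) \<in> ballot_pairs n"
  shows "({1..<n} - D, {1..<n} - A) \<in> ballot_pairs n"
proof -
  from assms have A: "A \<subseteq> {1..<n}" and D: "D \<subseteq> {1..<n}" and card: "card A = card D"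
    and le: "\<And>t. card (A \<inter> {..t}) \<le> card (D \<inter> {..t})"
    by (auto simp: ballot_pairs_def)
  have compl: "card (({1..<n} - X) \<inter> {..t}) = card ({1..<n} \<inter> {..t}) - card (X \<inter> {..t})"
    if "X \<subseteq> {1..<n}" for X t
  proof -
    have "({1..<n} - X) \<inter> {..t} = {1..<n} \<inter> {..t} - X \<inter> {..t}" by auto
    moreover have "X \<inter> {..t} \<subseteq> {1..<n} \<inter> {..t}" using that by auto
    ultimately show ?thesis by (metis card_Diff_subset finite_Int finite_atMost)
  qed
  have "card (({1..<n} - D) \<inter> {..t}) \<le> card (({1..<n} - A) \<inter> {..t})" for t
    unfolding compl[OF A] compl[OF D] using le by (rule diff_le_mono2)
  moreover have "card ({1..<n} - D) = card ({1..<n} - A)"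
    using A D card by (simp add: card_Diff_subset finite_subset)
  ultimately show ?thesis by (simp add: ballot_pairs_def)
qed

lemma bij_betw_complement:
  "bij_betw (\<lambda>(A, D). ({1..<n} - D, {1..<n} - A)) (ballot_pairs n) (ballot_pairs n)"
proof -
  have maps: "(\<lambda>(A, D). ({1..<n} - D, {1..<n} - A)) \<in> ballot_pairs n \<rightarrow> ballot_pairs n"
    using complement_in_ballot_pairs by auto
  show ?thesis by (rule bij_betwI[OF maps maps]) (auto simp: ballot_pairs_def)
qed

text \<open>Reindexing along the involution replaces each size k by n - 1 - k, so the sum S
  satisfies S = (n - 1) N - S, where N is the number of pairs.\<close>

lemma sum_card_ballot_pairs:
  assumes "n \<ge> 1"
  shows "2 * (\<Sum>p\<in>ballot_pairs n. real (card (snd p))) = (real n - 1) * card (ballot_pairs n)"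
proof -
  let ?B = "ballot_pairs n"
  have "(\<Sum>p\<in>?B. real (card (snd p))) =
      (\<Sum>p\<in>?B. real (card (snd (case p of (A, D) \<Rightarrow> ({1..<n} - D, {1..<n} - A)))))"
    by (rule sum.reindex_bij_betw[OF bij_betw_complement, symmetric])
  also have "\<dots> = (\<Sum>p\<in>?B. (real n - 1) - real (card (snd p)))"
  proof (rule sum.cong)
    fix p assume "p \<in> ?B"
    then obtain A D where p: "p = (A, D)" "A \<subseteq> {1..<n}" "card A = card D"
      by (auto simp: ballot_pairs_def)
    \<comment> \<open>This keeps the natural-number subtraction exact when it is carried over to the
      reals.\<close>
    have "card A \<le> n - 1" using card_mono[OF _ p(2)] by simp
    moreover have "card ({1..<n} - A) = n - 1 - card A"
      using p(2) by (simp add: card_Diff_subset finite_subset)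
    ultimately show "real (card (snd (case p of (A, D) \<Rightarrow> ({1..<n} - D, {1..<n} - A)))) =
        (real n - 1) - real (card (snd p))"
      using p assms by simp
  qed simp
  also have "\<dots> = (real n - 1) * card ?B - (\<Sum>p\<in>?B. real (card (snd p)))"
    by (simp add: sum_subtractf)
  finally show ?thesis by simp
qed

section \<open>The expected number of lucky spots\<close>

theorem theorem4p2:
  fixes n :: nat
  assumes "n \<ge> 1"
  shows "measure_pmf.expectation (pmf_of_set (weakly_decreasing_parking_functions n))
           (\<lambda>prefs. real (card (lucky_spots n prefs))) = 1 / 2 * (real n + 1)"
proof -
  let ?W = "weakly_decreasing_parking_functions n" and ?B = "ballot_pairs n"
  have "(\<Sum>p\<in>?W. real (card (lucky_spots n p))) = (\<Sum>p\<in>?W. real (card (set p)))"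
    by (intro sum.cong) (auto simp: lucky_spots_decreasing weakly_decreasing_parking_functions_def
        parking_function_def)
  also have "\<dots> = (\<Sum>b\<in>staircases n. real (card (set (rev (map Suc b)))))"
    by (rule sum.reindex_bij_betw[OF bij_betw_staircases, symmetric])
  \<comment> \<open>The value 0 lies in every staircase but is dropped by \<open>encode\<close>;
    this extra unit raises the mean from (n - 1) / 2 to (n + 1) / 2.\<close>
  also have "\<dots> = (\<Sum>b\<in>staircases n. real (card (snd (encode b))) + 1)"
  proof (rule sum.cong)
    fix b assume "b \<in> staircases n"
    then have "0 \<in> set b" using staircasesD(5) assms by blast
    then have "card (set b) = Suc (card (set b - {0}))" by (simp only: card.remove finite_set)
    then show "real (card (set (rev (map Suc b)))) = real (card (snd (encode b))) + 1"
      by (simp add: encode_def card_image)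
  qed simp
  also have "\<dots> = (\<Sum>p\<in>?B. real (card (snd p)) + 1)"
    by (rule sum.reindex_bij_betw[OF bij_betw_encode[OF assms]])
  also have "\<dots> = (real n + 1) / 2 * card ?B"
    using sum_card_ballot_pairs[OF assms] by (simp add: sum.distrib field_simps)
  also have "card ?B = card ?W"
    using bij_betw_same_card[OF bij_betw_staircases, of n]
      bij_betw_same_card[OF bij_betw_encode[OF assms]] by simp
  finally have "(\<Sum>p\<in>?W. real (card (lucky_spots n p))) = (real n + 1) / 2 * card ?W" .
  \<comment> \<open>The expectation is the sum divided by \<open>card ?W\<close>, which can be
    cancelled because it is nonzero.\<close>
  moreover have "card ?W \<noteq> 0"
    by (simp add: finite_weakly_decreasing_parking_functions
        weakly_decreasing_parking_functions_nonempty)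
  ultimately show ?thesis
    by (simp add: integral_pmf_of_set finite_weakly_decreasing_parking_functions
        weakly_decreasing_parking_functions_nonempty)
qed

end
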